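(* For every $n\ge1$, the map $\theta$ sending a collapsed permutation $\pi=\pi_1\cdots\pi_{2n+2}$ of $[2n+2]$ to $\sigma=\sigma_1\cdots\sigma_{2n}$ with $\sigma_{2i-1}=\pi_{n+i+1}-1$ and $\sigma_{2i}=\pi_{i+1}-1$ for $1\le i\le n$ is a bijection from $\mathcal{CO}_{2n+2}$ onto $\mathfrak{D}_{2n}$.
   Context: A permutation $\pi$ of $[2m]$ is collapsed if $1+\lfloor k/2\rfloor\le\pi^{-1}(k)\le m+\lfloor k/2\rfloor$ for every $k\in[2m]$; $\mathcal{CO}_{2m}$ denotes the set of collapsed permutations of $[2m]$. $\mathfrak{D}_{2n}$ (D-permutations) is the set of permutations $\sigma$ of $[2n]$ with $\sigma_{2i}\le 2i$ and $\sigma_{2i-1}\ge 2i-1$ for all $i\in[n]$. *)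

theory Defs
  imports "HOL-Combinatorics.Permutations"
begin

text \<open>
  A permutation of the set of integers from 1 to N is a function on the naturals that
  permutes \<open>{1..N}\<close>; it is thus the identity outside \<open>{1..N}\<close>, and it is determined by
  its one-line word.
\<close>

definition collapsed_perms :: "nat \<Rightarrow> (nat \<Rightarrow> nat) set" where
  "collapsed_perms m =
     {\<pi>. \<pi> permutes {1..2*m} \<and>
          (\<forall>k\<in>{1..2*m}. 1 + k div 2 \<le> inv \<pi> k \<and> inv \<pi> k \<le> m + k div 2)}"

definition D_perms :: "nat \<Rightarrow> (nat \<Rightarrow> nat) set" where
  "D_perms n =
     {\<sigma>. \<sigma> permutes {1..2*n} \<and>
          (\<forall>i\<in>{1..n}. \<sigma> (2*i) \<le> 2*i \<and> \<sigma> (2*i - 1) \<ge> 2*i - 1)}"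

text \<open>
  The subtraction of 1 does not truncate on collapsed permutations: there the value 1 is taken
  at position 1, which the map does not read. Outside \<open>{1..2*n}\<close> the result is the identity,
  as required of a function that permutes \<open>{1..2*n}\<close>.
\<close>

definition theta :: "nat \<Rightarrow> (nat \<Rightarrow> nat) \<Rightarrow> (nat \<Rightarrow> nat)" where
  "theta n \<pi> = (\<lambda>j.
     if j \<in> {1..2*n}
     then (if odd j then \<pi> (n + (j + 1) div 2 + 1) - 1 else \<pi> (j div 2 + 1) - 1)
     else j)"

lemma theta_odd: "i \<in> {1..n} \<Longrightarrow> theta n \<pi> (2*i - 1) = \<pi> (n + i + 1) - 1"
  by (auto simp: theta_def)

lemma theta_even: "i \<in> {1..n} \<Longrightarrow> theta n \<pi> (2*i) = \<pi> (i + 1) - 1"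
  by (auto simp: theta_def)

end

theory Submission
  imports Defs
begin

text \<open>
  In terms of positions, a permutation is collapsed iff the value at position \<open>p\<close> satisfies
  \<open>2 * (p - m) \<le> \<pi> p \<le> 2 * p - 1\<close>. This forces \<open>\<pi> 1 = 1\<close> and \<open>\<pi> (2 * m) = 2 * m\<close>. For
  \<open>m = n + 1\<close>, only the upper bound is a constraint at the positions \<open>2, \<dots>, n + 1\<close>, and only the
  lower bound at the positions \<open>n + 2, \<dots>, 2 * n + 1\<close>; after the shift by one and the relabelling of
  positions, these are the two conditions that define D-permutations.
\<close>

lemma collapsed_perms_iff:
  "\<pi> \<in> collapsed_perms m \<longleftrightarrow>
     \<pi> permutes {1..2*m} \<and> (\<forall>p\<in>{1..2*m}. 1 + \<pi> p div 2 \<le> p \<and> p \<le> m + \<pi> p div 2)"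
proof (cases "\<pi> permutes {1..2*m}")
  case True
  \<comment> \<open>Since \<pi> maps the interval onto itself, every \<open>k\<close> may be written
    as \<open>\<pi> p\<close>, and then the inverse cancels.\<close>
  have "(\<forall>k\<in>{1..2*m}. 1 + k div 2 \<le> inv \<pi> k \<and> inv \<pi> k \<le> m + k div 2) \<longleftrightarrow>
        (\<forall>k\<in>\<pi> ` {1..2*m}. 1 + k div 2 \<le> inv \<pi> k \<and> inv \<pi> k \<le> m + k div 2)"
    using permutes_image[OF True] by simp
  also have "\<dots> \<longleftrightarrow> (\<forall>p\<in>{1..2*m}. 1 + \<pi> p div 2 \<le> p \<and> p \<le> m + \<pi> p div 2)"
    using permutes_inverses(2)[OF True] by simp
  finally show ?thesis
    using True by (simp add: collapsed_perms_def)
qed (simp add: collapsed_perms_def)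

text \<open>Isolates the relabelling of positions in \<open>theta\<close>: on
  \<open>{1..2*n}\<close>, \<open>theta n \<pi>\<close> is \<open>theta_pos n\<close>, then \<pi>,
  then the predecessor.\<close>

definition theta_pos :: "nat \<Rightarrow> nat \<Rightarrow> nat" where
  "theta_pos n j = (if odd j then n + (j + 1) div 2 + 1 else j div 2 + 1)"

text \<open>The inverse of \<open>theta_pos n\<close>, for positions in \<open>{2..2*n+1}\<close>;
  no subtraction truncates there.\<close>

definition theta_slot :: "nat \<Rightarrow> nat \<Rightarrow> nat" where
  "theta_slot n p = (if p \<le> n + 1 then 2 * (p - 1) else 2 * (p - n - 1) - 1)"

lemma theta_eq_pos: "theta n \<pi> = (\<lambda>j. if j \<in> {1..2*n} then \<pi> (theta_pos n j) - 1 else j)"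
  by (auto simp: theta_def theta_pos_def)

lemma theta_pos_in: "j \<in> {1..2*n} \<Longrightarrow> theta_pos n j \<in> {2..2*n+1}"
  by (auto simp: theta_pos_def elim!: oddE evenE)

lemma theta_slot_in: "p \<in> {2..2*n+1} \<Longrightarrow> theta_slot n p \<in> {1..2*n}"
  by (auto simp: theta_slot_def)

lemma theta_slot_pos: "j \<in> {1..2*n} \<Longrightarrow> theta_slot n (theta_pos n j) = j"
  by (auto simp: theta_pos_def theta_slot_def elim!: oddE evenE)

lemma theta_pos_slot: "p \<in> {2..2*n+1} \<Longrightarrow> theta_pos n (theta_slot n p) = p"
  by (auto simp: theta_pos_def theta_slot_def)

lemma bij_betw_theta_pos: "bij_betw (theta_pos n) {1..2*n} {2..2*n+1}"
  by (rule bij_betw_byWitness[where f' = "theta_slot n"])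
    (use theta_pos_in theta_slot_in theta_slot_pos theta_pos_slot in blast)+

lemma bij_betw_theta_slot: "bij_betw (theta_slot n) {2..2*n+1} {1..2*n}"
  by (rule bij_betw_byWitness[where f' = "theta_pos n"])
    (use theta_pos_in theta_slot_in theta_slot_pos theta_pos_slot in blast)+

text \<open>The default value \<open>p\<close> also covers \<open>1\<close> and
  \<open>2*n+2\<close>, the two points that every collapsed permutation fixes.\<close>

definition theta_inv :: "nat \<Rightarrow> (nat \<Rightarrow> nat) \<Rightarrow> (nat \<Rightarrow> nat)" where
  "theta_inv n \<sigma> = (\<lambda>p. if p \<in> {2..2*n+1} then \<sigma> (theta_slot n p) + 1 else p)"

lemma bij_betw_pred: "bij_betw (\<lambda>k. k - 1) {2..2*n+1} {1..2*n::nat}"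
  by (rule bij_betw_byWitness[where f' = Suc]) auto

lemma bij_betw_succ: "bij_betw (\<lambda>k. k + 1) {1..2*n::nat} {2..2*n+1}"
  by (rule bij_betw_byWitness[where f' = "\<lambda>k. k - 1"]) (auto simp: image_subset_iff)

text \<open>The upper bound at position 1 leaves only the values 0 and 1, and 0 lies outside the
  interval.\<close>

lemma collapsed_perms_fix_first:
  assumes "\<pi> \<in> collapsed_perms (n + 1)"
  shows "\<pi> 1 = 1"
proof -
  have perm: "\<pi> permutes {1..2*(n+1)}"
    and bound: "\<forall>p\<in>{1..2*(n+1)}. 1 + \<pi> p div 2 \<le> p"
    using assms by (auto simp: collapsed_perms_iff)
  have "1 + \<pi> 1 div 2 \<le> 1"
    by (rule bspec[OF bound]) simp
  moreover from perm have "\<pi> 1 \<in> {1..2*(n+1)}"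
    by (simp only: permutes_in_image) simp
  ultimately show ?thesis
    unfolding atLeastAtMost_iff by presburger
qed

text \<open>The lower bound at the last position is already the largest value available.\<close>

lemma collapsed_perms_fix_last:
  assumes "\<pi> \<in> collapsed_perms (n + 1)"
  shows "\<pi> (2*n+2) = 2*n+2"
proof -
  have "\<pi> permutes {1..2*(n+1)}"
    and bound: "\<forall>p\<in>{1..2*(n+1)}. p \<le> n + 1 + \<pi> p div 2"
    using assms by (auto simp: collapsed_perms_iff)
  from this(1) have "\<pi> (2*n+2) \<in> {1..2*(n+1)}"
    by (simp only: permutes_in_image) simp
  moreover have "2*n+2 \<le> n + 1 + \<pi> (2*n+2) div 2"
    by (rule bspec[OF bound]) simp
  ultimately show ?thesis
    unfolding atLeastAtMost_iff by presburger
qed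

text \<open>The positions that \<open>theta\<close> reads thus carry exactly the values
  \<open>2\<close> to \<open>2*n+1\<close>, which the predecessor maps bijectively onto
  \<open>{1..2*n}\<close>.\<close>

lemma collapsed_perms_permutes_middle:
  assumes "\<pi> \<in> collapsed_perms (n + 1)"
  shows "\<pi> permutes {2..2*n+1}"
proof (rule permutes_superset)
  show "\<pi> permutes {1..2*(n+1)}"
    using assms by (simp add: collapsed_perms_iff)
  show "\<pi> p = p" if "p \<in> {1..2*(n+1)} - {2..2*n+1}" for p
  proof -
    have "p = 1 \<or> p = 2*n+2"
      using that by auto
    then show ?thesis
      using collapsed_perms_fix_first[OF assms] collapsed_perms_fix_last[OF assms] by blast
  qed
qed

lemma theta_in_D_perms:
  assumes "\<pi> \<in> collapsed_perms (n + 1)"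
  shows "theta n \<pi> \<in> D_perms n"
proof -
  have mid: "\<pi> permutes {2..2*n+1}"
    by (rule collapsed_perms_permutes_middle[OF assms])
  have bound: "1 + \<pi> p div 2 \<le> p \<and> p \<le> n + 1 + \<pi> p div 2" if "p \<in> {1..2*(n+1)}" for p
    using assms that by (simp add: collapsed_perms_iff)
  have "bij_betw ((\<lambda>k. k - 1) \<circ> (\<pi> \<circ> theta_pos n)) {1..2*n} {1..2*n}"
    using bij_betw_theta_pos permutes_imp_bij[OF mid] bij_betw_pred
    by (blast intro: bij_betw_trans)
  then have "bij_betw (theta n \<pi>) {1..2*n} {1..2*n}"
    by (rule bij_betw_cong[THEN iffD1, rotated]) (simp add: theta_eq_pos)
  then have "theta n \<pi> permutes {1..2*n}"
    by (rule bij_imp_permutes) (auto simp: theta_def)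
  \<comment> \<open>The bounds at positions \<open>i + 1\<close> and \<open>n + i + 1\<close> say
    \<open>\<pi> (i + 1) \<le> 2*i + 1\<close> and \<open>\<pi> (n + i + 1) \<ge> 2*i\<close>;
    subtract 1.\<close>
  moreover have "theta n \<pi> (2*i) \<le> 2*i \<and> theta n \<pi> (2*i - 1) \<ge> 2*i - 1" if "i \<in> {1..n}" for i
    using that bound[of "i + 1"] bound[of "n + i + 1"]
    unfolding theta_even[OF that] theta_odd[OF that] by auto
  ultimately show ?thesis
    by (simp add: D_perms_def)
qed

lemma theta_inv_in_collapsed_perms:
  assumes "\<sigma> \<in> D_perms n"
  shows "theta_inv n \<sigma> \<in> collapsed_perms (n + 1)"
proof -
  have perm: "\<sigma> permutes {1..2*n}"
    and even_le: "i \<in> {1..n} \<Longrightarrow> \<sigma> (2*i) \<le> 2*i"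
    and odd_ge: "i \<in> {1..n} \<Longrightarrow> \<sigma> (2*i - 1) \<ge> 2*i - 1" for i
    using assms by (auto simp: D_perms_def)
  have "bij_betw ((\<lambda>k. k + 1) \<circ> (\<sigma> \<circ> theta_slot n)) {2..2*n+1} {2..2*n+1}"
    using bij_betw_theta_slot permutes_imp_bij[OF perm] bij_betw_succ
    by (blast intro: bij_betw_trans)
  then have "bij_betw (theta_inv n \<sigma>) {2..2*n+1} {2..2*n+1}"
    by (rule bij_betw_cong[THEN iffD1, rotated]) (simp add: theta_inv_def)
  then have "theta_inv n \<sigma> permutes {2..2*n+1}"
    by (rule bij_imp_permutes) (auto simp: theta_inv_def)
  then have "theta_inv n \<sigma> permutes {1..2*(n+1)}"
    by (rule permutes_subset) auto
  moreover have "1 + theta_inv n \<sigma> p div 2 \<le> p \<and> p \<le> n + 1 + theta_inv n \<sigma> p div 2"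
    if p: "p \<in> {1..2*(n+1)}" for p
  proof -
    consider "p = 1 \<or> p = 2*n+2" | "p \<in> {2..n+1}" | "p \<in> {n+2..2*n+1}"
      using p by force
    then show ?thesis
    proof cases
      case 1
      then show ?thesis
        by (auto simp: theta_inv_def)
    next
      case 2
      then have "theta_inv n \<sigma> p = \<sigma> (2 * (p - 1)) + 1"
        by (simp add: theta_inv_def theta_slot_def)
      \<comment> \<open>So the value at \<open>p\<close> is at most \<open>2*p - 1\<close>, whose
        half rounds down to \<open>p - 1\<close>. The other bound follows from
        \<open>p \<le> n + 1\<close>.\<close>
      moreover have "\<sigma> (2 * (p - 1)) \<le> 2 * (p - 1)"
        using 2 by (intro even_le) auto
      ultimately show ?thesis
        using 2 by auto
    next
      case 3
      then have eq: "theta_inv n \<sigma> p = \<sigma> (2 * (p - n - 1) - 1) + 1"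
        by (simp add: theta_inv_def theta_slot_def)
      have "\<sigma> (2 * (p - n - 1) - 1) \<ge> 2 * (p - n - 1) - 1"
        using 3 by (intro odd_ge) auto
      \<comment> \<open>Gives the upper bound: the value at \<open>p\<close> is at most
        \<open>2*n + 1\<close>, so its half rounds down to at most \<open>n\<close>, while
        \<open>p \<ge> n + 2\<close>.\<close>
      moreover have "\<sigma> (2 * (p - n - 1) - 1) \<in> {1..2*n}"
        unfolding permutes_in_image[OF perm] using 3 by auto
      ultimately show ?thesis
        unfolding eq using 3 by (auto; linarith)
    qed
  qed
  ultimately show ?thesis
    by (simp add: collapsed_perms_iff)
qed

lemma theta_inv_theta:
  assumes "\<pi> \<in> collapsed_perms (n + 1)"
  shows "theta_inv n (theta n \<pi>) = \<pi>"
proof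
  fix p
  have mid: "\<pi> permutes {2..2*n+1}"
    by (rule collapsed_perms_permutes_middle[OF assms])
  show "theta_inv n (theta n \<pi>) p = \<pi> p"
  proof (cases "p \<in> {2..2*n+1}")
    case True
    \<comment> \<open>Hence \<open>\<pi> p\<close> is positive, and adding 1 undoes the truncated
      subtraction in \<open>theta\<close>.\<close>
    then have "\<pi> p \<in> {2..2*n+1}"
      by (simp only: permutes_in_image[OF mid])
    with True show ?thesis
      using theta_slot_in[OF True] theta_pos_slot[OF True]
      by (simp add: theta_inv_def theta_eq_pos)
  next
    case False
    then show ?thesis
      using permutes_not_in[OF mid False] by (simp only: theta_inv_def if_False)
  qed
qed

lemma theta_theta_inv:
  assumes "\<sigma> \<in> D_perms n"
  shows "theta n (theta_inv n \<sigma>) = \<sigma>"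
proof
  fix j
  have perm: "\<sigma> permutes {1..2*n}"
    using assms by (simp add: D_perms_def)
  show "theta n (theta_inv n \<sigma>) j = \<sigma> j"
  proof (cases "j \<in> {1..2*n}")
    case True
    then show ?thesis
      using theta_pos_in[OF True] theta_slot_pos[OF True]
      by (simp add: theta_inv_def theta_eq_pos)
  next
    case False
    then show ?thesis
      using permutes_not_in[OF perm False] by (simp only: theta_eq_pos if_False)
  qed
qed

theorem theorem4p4:
  fixes n :: nat
  assumes "n \<ge> 1"
  shows "bij_betw (theta n) (collapsed_perms (n + 1)) (D_perms n)"
  by (rule bij_betw_byWitness[where f' = "theta_inv n"])
    (use theta_inv_theta theta_theta_inv theta_in_D_perms theta_inv_in_collapsed_perms in blast)+

end
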